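(* Let $P \subseteq \mathbb{R}^d$ be a full-dimensional polytope such that $L_P(s) = L_P(\lfloor s \rfloor)$ for all real $s \ge 0$. Then $P$ can be written as $$P = \bigcap_{i=1}^n \{x \in \mathbb{R}^d \mid \langle a_i, x\rangle \le b_i\},$$ with $a_i \in \mathbb{R}^d$, where each $b_i$ is either $0$ or $1$, and $a_i \in \mathbb{Z}^d$ whenever $b_i = 1$.
   Context: For a polytope $P \subseteq \mathbb{R}^d$ and real $s > 0$, let $L_P(s) = \#(sP \cap \mathbb{Z}^d)$, where $sP = \{sx \mid x \in P\}$ and $\#$ denotes cardinality; by convention $L_P(0) = 1$. *)

theory Defs
  imports "HOL-Analysis.Analysis"
begin

definition integer_lattice :: "(real ^ 'n) set" where
  "integer_lattice = {x. \<forall>j. x $ j \<in> \<int>}"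

text \<open>The value at \<open>s = 0\<close> is a convention; negative parameters are not used.
  For bounded \<open>P\<close> the set being counted is finite, so \<^const>\<open>card\<close> is the true cardinality.\<close>

definition ehrhart :: "(real ^ 'n) set \<Rightarrow> real \<Rightarrow> nat" where
  "ehrhart P s = (if s = 0 then 1 else card ((\<lambda>x. s *\<^sub>R x) ` P \<inter> integer_lattice))"

end

theory Submission
  imports Defs
begin

text \<open>Letting \<open>s \<rightarrow> 0\<close> shows \<open>0 \<in> P\<close>, so the sets \<open>sP\<close> increase with \<open>s\<close>, and the hypothesis says that
  \<open>sP\<close> and \<open>\<lfloor>s\<rfloor>P\<close> contain the same lattice points.  Let \<open>{x. a \<bullet> x \<le> 1}\<close> be one of the halfspaces of an
  irredundant description of \<open>P\<close>.  The points projecting radially into the interior of the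
  corresponding facet form an open cone.  A lattice point \<open>x\<close> of this cone lies in \<open>sP\<close> exactly when
  \<open>a \<bullet> x \<le> s\<close>, hence \<open>a \<bullet> x\<close> is an integer.  The cone contains arbitrarily large balls, so it contains
  a lattice point together with all its neighbours \<open>x + e\<^sub>j\<close>, and \<open>a $ j = a \<bullet> (x + e\<^sub>j) - a \<bullet> x\<close> is an
  integer too.\<close>

lemma finite_bounded_Int_integer_lattice:
  fixes S :: "(real ^ 'n) set"
  assumes "bounded S"
  shows "finite (S \<inter> integer_lattice)"
proof -
  obtain B where B: "\<And>x. x \<in> S \<Longrightarrow> norm x \<le> B"
    using assms by (auto simp: bounded_iff)
  let ?K = "{k \<in> \<int>. \<bar>k\<bar> \<le> B}"
  have "S \<inter> integer_lattice \<subseteq> vec_lambda ` (PiE UNIV (\<lambda>_::'n. ?K))"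
  proof
    fix x assume x: "x \<in> S \<inter> integer_lattice"
    have "\<bar>x $ j\<bar> \<le> B" for j
      using B component_le_norm_cart[of x j] x by (meson IntD1 order_trans)
    then have "vec_nth x \<in> PiE UNIV (\<lambda>_. ?K)"
      using x by (auto simp: integer_lattice_def)
    then show "x \<in> vec_lambda ` (PiE UNIV (\<lambda>_. ?K))"
      by (metis image_eqI vec_nth_inverse)
  qed
  moreover have "finite ?K"
    by (rule finite_abs_int_segment)
  ultimately show ?thesis
    by (meson finite finite_PiE finite_imageI finite_subset)
qed

text \<open>Scaling a ball inside \<open>U\<close> gives balls of any radius inside
  \<open>U\<close>; a large enough one contains a rounded copy of its centre together with all unit
  steps from it.\<close>

lemma open_cone_contains_unit_corner:
  fixes U :: "(real ^ 'n) set"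
  assumes "open U" "y \<in> U"
    and scale: "\<And>t z. t > 0 \<Longrightarrow> z \<in> U \<Longrightarrow> t *\<^sub>R z \<in> U"
  obtains x where "x \<in> integer_lattice" "x \<in> U" "\<And>j. x + axis j 1 \<in> U"
proof -
  obtain r where r: "r > 0" "ball y r \<subseteq> U"
    using assms by (meson openE)
  \<comment> \<open>The scaled ball has radius \<open>CARD('n) + 2\<close>: rounding the centre
    costs at most \<open>CARD('n)\<close>, a unit step costs 1, and the rest keeps the inequality
    strict.\<close>
  define t where "t = (real CARD('n) + 2) / r"
  have t: "t > 0" "t * r = real CARD('n) + 2"
    using r by (auto simp: t_def)
  have near: "z \<in> U" if "norm (z - t *\<^sub>R y) < t * r" for z
  proof -
    have "z - t *\<^sub>R y = t *\<^sub>R ((1 / t) *\<^sub>R z - y)"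
      using t by (simp add: scaleR_diff_right)
    then have "t * norm ((1 / t) *\<^sub>R z - y) < t * r"
      using that t(1) by (metis abs_of_pos norm_scaleR)
    then have "norm ((1 / t) *\<^sub>R z - y) < r"
      using t(1) by simp
    then have "(1 / t) *\<^sub>R z \<in> U"
      using r by (auto simp: dist_norm norm_minus_commute subset_iff)
    from scale[OF t(1) this] show ?thesis
      using t by simp
  qed
  define x :: "real ^ 'n" where "x = (\<chi> j. of_int \<lfloor>t * y $ j\<rfloor>)"
  have "norm (x - t *\<^sub>R y) \<le> (\<Sum>j\<in>UNIV. \<bar>(x - t *\<^sub>R y) $ j\<bar>)"
    by (rule norm_le_l1_cart)
  also have "\<dots> \<le> (\<Sum>j\<in>(UNIV::'n set). 1)"
    unfolding x_def vector_minus_component vector_scaleR_component vec_lambda_beta real_scaleR_def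
    by (rule sum_mono) linarith
  finally have x: "norm (x - t *\<^sub>R y) \<le> real CARD('n)"
    by simp
  show ?thesis
  proof (rule that)
    show "x \<in> integer_lattice"
      by (simp add: x_def integer_lattice_def)
    show "x \<in> U"
      using near x t by simp
    fix j
    have "norm (x + axis j 1 - t *\<^sub>R y) \<le> norm (x - t *\<^sub>R y) + norm (axis j (1::real) :: real ^ 'n)"
      by (metis add_diff_eq add.commute norm_triangle_ineq diff_add_eq)
    also have "\<dots> < t * r"
      using x t by (simp add: norm_axis_1)
    finally show "x + axis j 1 \<in> U"
      by (rule near)
  qed
qed

lemma zero_in_if_ehrhart_floor:
  fixes P :: "(real ^ 'n) set"
  assumes "bounded P"
    and floor: "\<And>s::real. s \<ge> 0 \<Longrightarrow> ehrhart P s = ehrhart P (of_int \<lfloor>s\<rfloor>)"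
  shows "0 \<in> P"
proof -
  obtain B where B: "B > 0" "\<And>x. x \<in> P \<Longrightarrow> norm x \<le> B"
    using assms by (auto simp: bounded_pos)
  define s where "s = 1 / (B + 1)"
  have s: "0 < s" "s < 1" "s * B < 1"
    using B by (auto simp: s_def field_simps)
  then have "\<lfloor>s\<rfloor> = 0"
    by (simp add: floor_eq_iff)
  \<comment> \<open>The convention \<open>ehrhart P 0 = 1\<close> enters here: it forces a lattice
    point into \<open>sP\<close>, and the open unit ball around \<open>sP\<close> leaves only the
    origin.\<close>
  then have "card ((\<lambda>x. s *\<^sub>R x) ` P \<inter> integer_lattice) = 1"
    using floor[of s] s by (simp add: ehrhart_def)
  then obtain p where p: "p \<in> P" "s *\<^sub>R p \<in> integer_lattice"
    by (metis (no_types, lifting) card_1_singletonE IntE imageE insertI1)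
  have "norm (s *\<^sub>R p) < 1"
    using B(2)[OF p(1)] s by (simp add: order_le_less_trans[OF mult_left_mono])
  then have "\<bar>(s *\<^sub>R p) $ j\<bar> < 1" for j
    by (meson component_le_norm_cart order_le_less_trans)
  then have "(s *\<^sub>R p) $ j = 0" for j
    using p(2) unfolding integer_lattice_def by (metis (mono_tags, lifting) Ints_nonzero_abs_less1 mem_Collect_eq)
  then have "p = 0"
    using s by (simp add: vec_eq_iff)
  with p show ?thesis
    by simp
qed

text \<open>Since \<open>P\<close> is convex and contains 0, the smaller dilate lies in the larger
  one; a subset of a finite set with the same cardinality is the whole set.\<close>

lemma lattice_point_in_floor_dilate:
  fixes P :: "(real ^ 'n) set"
  assumes "bounded P" "convex P"
    and floor: "\<And>s::real. s \<ge> 0 \<Longrightarrow> ehrhart P s = ehrhart P (of_int \<lfloor>s\<rfloor>)"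
    and "s \<ge> 0" "p \<in> P" "s *\<^sub>R p \<in> integer_lattice"
  obtains q where "q \<in> P" "s *\<^sub>R p = of_int \<lfloor>s\<rfloor> *\<^sub>R q"
proof -
  have 0: "0 \<in> P"
    using zero_in_if_ehrhart_floor[OF assms(1) floor] .
  define D where "D r = (\<lambda>x. r *\<^sub>R x) ` P \<inter> integer_lattice" for r
  \<comment> \<open>As 0 lies in \<open>P\<close>, the conventional value at 0 is the true count, so
    the case of floor 0 needs no separate treatment.\<close>
  have "D 0 = {0}"
    using 0 by (auto simp: D_def integer_lattice_def)
  then have E: "ehrhart P r = card (D r)" for r
    by (simp add: ehrhart_def D_def)
  have "D (of_int \<lfloor>s\<rfloor>) \<subseteq> D s"
  proof (cases "s = 0")
    case False
    have "of_int \<lfloor>s\<rfloor> *\<^sub>R q \<in> (\<lambda>x. s *\<^sub>R x) ` P" if "q \<in> P" for q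
    proof
      show "of_int \<lfloor>s\<rfloor> *\<^sub>R q = s *\<^sub>R ((of_int \<lfloor>s\<rfloor> / s) *\<^sub>R q)"
        using False by simp
      have "0 \<le> of_int \<lfloor>s\<rfloor> / s" "of_int \<lfloor>s\<rfloor> / s \<le> 1"
        using \<open>s \<ge> 0\<close> False by auto
      then show "(of_int \<lfloor>s\<rfloor> / s) *\<^sub>R q \<in> P"
        using convexD_alt[OF \<open>convex P\<close> 0 that] by simp
    qed
    then show ?thesis
      by (auto simp: D_def)
  qed simp
  moreover have "finite (D s)"
    unfolding D_def using assms(1) by (intro finite_bounded_Int_integer_lattice bounded_scaling)
  moreover have "card (D (of_int \<lfloor>s\<rfloor>)) = card (D s)"
    using floor[OF \<open>s \<ge> 0\<close>] by (simp add: E)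
  ultimately have "D (of_int \<lfloor>s\<rfloor>) = D s"
    by (metis card_subset_eq)
  moreover have "s *\<^sub>R p \<in> D s"
    using assms(5,6) by (auto simp: D_def)
  ultimately show ?thesis
    using that by (auto simp: D_def)
qed

text \<open>In the application, \<open>Q\<close> is the intersection of the remaining halfspaces,
  and \<open>P \<noteq> Q\<close> expresses irredundancy of the halfspace given by
  \<open>a\<close>.\<close>

lemma facet_normal_integral:
  fixes P Q :: "(real ^ 'n) set"
  assumes "bounded P" "convex Q" "interior P \<noteq> {}"
    and floor: "\<And>s::real. s \<ge> 0 \<Longrightarrow> ehrhart P s = ehrhart P (of_int \<lfloor>s\<rfloor>)"
    and P: "P = {x. a \<bullet> x \<le> 1} \<inter> Q"
    and "P \<noteq> Q"
  shows "a \<in> integer_lattice"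
proof (cases "a = 0")
  case True
  then show ?thesis
    by (simp add: integer_lattice_def)
next
  case False
  have "convex P"
    unfolding P using \<open>convex Q\<close> by (intro convex_Int convex_halfspace_le)
  obtain p where p: "p \<in> interior P"
    using assms by blast
  have p1: "a \<bullet> p < 1" and pQ: "p \<in> interior Q"
    using p False unfolding P by auto
  obtain x where x: "x \<in> Q" "a \<bullet> x > 1"
    using \<open>P \<noteq> Q\<close> unfolding P by force
  \<comment> \<open>The parameter at which the segment from \<open>p\<close> to \<open>x\<close>
    crosses the hyperplane \<open>a \<bullet> z = 1\<close>; the crossing point \<open>y\<close>
    stays interior to \<open>Q\<close> because \<open>p\<close> is.\<close>
  define u where "u = (1 - a \<bullet> p) / (a \<bullet> x - a \<bullet> p)"
  have u: "0 < u" "u < 1"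
    using p1 x by (auto simp: u_def)
  define y where "y = (1 - u) *\<^sub>R p + u *\<^sub>R x"
  have "a \<bullet> y = a \<bullet> p + u * (a \<bullet> x - a \<bullet> p)"
    by (simp add: y_def inner_right_distrib algebra_simps)
  also have "\<dots> = 1"
    using p1 x by (simp add: u_def)
  finally have y1: "a \<bullet> y = 1" .
  have "p \<noteq> x"
    using p1 x by auto
  then have "y \<in> open_segment p x"
    using u by (auto simp: in_segment y_def)
  then have yQ: "y \<in> interior Q"
    using in_interior_closure_convex_segment[OF \<open>convex Q\<close> pQ] x closure_subset by blast
  \<comment> \<open>The second factor asks that the radial projection of \<open>z\<close> to the
    hyperplane \<open>a \<bullet> z = 1\<close> be interior to \<open>Q\<close>; the first makes
    this projection continuous.\<close>
  define U where "U = {z. a \<bullet> z > 0} \<inter> (\<lambda>z. (1 / (a \<bullet> z)) *\<^sub>R z) -` interior Q"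
  have "open U"
    unfolding U_def
    by (intro continuous_open_preimage continuous_intros open_halfspace_gt open_interior) auto
  moreover have "y \<in> U"
    using y1 yQ by (simp add: U_def)
  moreover have "t *\<^sub>R z \<in> U" if "t > 0" "z \<in> U" for t z
    using that by (simp add: U_def)
  ultimately obtain x where x: "x \<in> integer_lattice" "x \<in> U" "\<And>j. x + axis j 1 \<in> U"
    using open_cone_contains_unit_corner by metis
  have int: "a \<bullet> z \<in> \<int>" if z: "z \<in> U" "z \<in> integer_lattice" for z
  proof -
    define s where "s = a \<bullet> z"
    have s: "s > 0" "(1 / s) *\<^sub>R z \<in> Q"
      using z interior_subset by (auto simp: U_def s_def)
    then have "(1 / s) *\<^sub>R z \<in> P"
      by (simp add: P s_def)
    moreover have "s *\<^sub>R ((1 / s) *\<^sub>R z) = z"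
      using s by simp
    ultimately obtain q where q: "q \<in> P" "z = of_int \<lfloor>s\<rfloor> *\<^sub>R q"
      using lattice_point_in_floor_dilate[OF \<open>bounded P\<close> \<open>convex P\<close> floor, of s "(1 / s) *\<^sub>R z"] s z
      by (metis less_imp_le)
    \<comment> \<open>Membership of \<open>z\<close> in the floor dilate bounds
      \<open>s = a \<bullet> z\<close> by its own floor.\<close>
    have "s = of_int \<lfloor>s\<rfloor> * (a \<bullet> q)"
      using arg_cong[OF q(2), of "inner a"] by (simp add: s_def)
    also have "\<dots> \<le> of_int \<lfloor>s\<rfloor> * 1"
      using q(1) s by (intro mult_left_mono) (auto simp: P)
    finally have "s = of_int \<lfloor>s\<rfloor>"
      by linarith
    then show ?thesis
      by (metis Ints_of_int s_def)
  qed
  have "a $ j \<in> \<int>" for j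
  proof -
    have "x + axis j 1 \<in> integer_lattice"
      using x(1) by (auto simp: integer_lattice_def axis_def)
    then have "a \<bullet> (x + axis j 1) - a \<bullet> x \<in> \<int>"
      using int x by (intro Ints_diff) auto
    then show ?thesis
      by (simp add: inner_right_distrib inner_axis)
  qed
  then show ?thesis
    by (simp add: integer_lattice_def)
qed

theorem theorem5:
  fixes P :: "(real ^ 'd) set"
  assumes "polytope P"
    and "aff_dim P = int CARD('d)"
    and "\<And>s::real. s \<ge> 0 \<Longrightarrow> ehrhart P s = ehrhart P (of_int \<lfloor>s\<rfloor>)"
  shows "\<exists>(n::nat) (a :: nat \<Rightarrow> real ^ 'd) (b :: nat \<Rightarrow> real).
           P = (\<Inter>i\<in>{1..n}. {x. a i \<bullet> x \<le> b i}) \<and>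
           (\<forall>i\<in>{1..n}. b i = 0 \<or> b i = 1) \<and>
           (\<forall>i\<in>{1..n}. b i = 1 \<longrightarrow> a i \<in> integer_lattice)"
proof -
  have bnd: "bounded P" and "convex P"
    using assms(1) by (auto intro: polytope_imp_bounded polytope_imp_convex)
  have 0: "0 \<in> P"
    using zero_in_if_ehrhart_floor[OF bnd assms(3)] .
  have aff: "affine hull P = UNIV"
    using assms(2) aff_dim_eq_full[of P] by simp
  have int: "interior P \<noteq> {}"
    using rel_interior_interior[OF aff] rel_interior_eq_empty[OF \<open>convex P\<close>] 0 by auto
  \<comment> \<open>Full dimension makes the affine hull the whole space, so the minimal description
    consists of halfspaces alone.\<close>
  obtain F where F: "finite F" "P = \<Inter>F"
    and half: "\<forall>h\<in>F. \<exists>a b. a \<noteq> 0 \<and> h = {x. a \<bullet> x \<le> b}"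
    and min: "\<forall>F'. F' \<subset> F \<longrightarrow> P \<subset> \<Inter>F'"
    using polytope_imp_polyhedron[OF assms(1)] unfolding polyhedron_Int_affine_minimal aff by auto
  have "\<exists>a b. h = {x. a \<bullet> x \<le> b} \<and> (b = 0 \<or> b = 1) \<and> (b = 1 \<longrightarrow> a \<in> integer_lattice)"
    if h: "h \<in> F" for h
  proof -
    obtain a b where ab: "h = {x. a \<bullet> x \<le> b}"
      using half h by blast
    have "b \<ge> 0"
      using 0 F(2) h ab by auto
    show ?thesis
    proof (cases "b = 0")
      case True
      then show ?thesis
        using ab by (intro exI[of _ a] exI[of _ 0]) simp
    next
      case False
      with \<open>b \<ge> 0\<close> have "b > 0"
        by simp
      \<comment> \<open>Dividing by the positive \<open>b\<close> normalizes the right-hand side to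
        1, and integrality is claimed for the rescaled normal.\<close>
      then have h1: "h = {x. ((1 / b) *\<^sub>R a) \<bullet> x \<le> 1}"
        by (simp add: ab)
      have "P = h \<inter> \<Inter>(F - {h})"
        using F(2) h by auto
      moreover have "P \<noteq> \<Inter>(F - {h})"
        using min h by (metis DiffD2 Diff_subset insertI1 psubsetI psubset_eq)
      moreover have "convex (\<Inter>(F - {h}))"
        by (rule convex_Inter) (use half in \<open>metis DiffD1 convex_halfspace_le\<close>)
      ultimately have "(1 / b) *\<^sub>R a \<in> integer_lattice"
        using facet_normal_integral[OF bnd _ int assms(3)] unfolding h1 by blast
      with h1 show ?thesis
        by blast
    qed
  qed
  then obtain a b where ab: "\<And>h. h \<in> F \<Longrightarrow>
      h = {x. a h \<bullet> x \<le> b h} \<and> (b h = 0 \<or> b h = 1) \<and> (b h = 1 \<longrightarrow> a h \<in> integer_lattice)"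
    by metis
  obtain f where f: "bij_betw f {1..card F} F"
    using F(1) ex_bij_betw_nat_finite_1 by blast
  then have mem: "f i \<in> F" if "i \<in> {1..card F}" for i
    using that bij_betwE by blast
  have "P = (\<Inter>i\<in>{1..card F}. f i)"
    using F(2) f by (simp add: bij_betw_def)
  also have "\<dots> = (\<Inter>i\<in>{1..card F}. {x. a (f i) \<bullet> x \<le> b (f i)})"
    using ab mem by (intro INF_cong) auto
  finally show ?thesis
    using ab mem
    by (intro exI[of _ "card F"] exI[of _ "a \<circ> f"] exI[of _ "b \<circ> f"]) auto
qed

end
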